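(* Let $R$ be a 2-Henselian valuation ring such that $2\in R^{*}$, and let $M$ and $N$ be $R$-lattices with Jordan decompositions $M=\bigoplus_{k=1}^{t}M_{k}$ and $N=\bigoplus_{k=1}^{s}N_{k}$, ordered so that $v(M_{1})<\cdots<v(M_{t})$ and $v(N_{1})<\cdots<v(N_{s})$. If $M\cong N$, then $t=s$ and $M_{k}\cong N_{k}$ for every $k$ (and in particular $v(M_{k})=v(N_{k})$).
   Context: A valuation ring $R$ is an integral domain with fraction field $\mathbb{K}$, together with a totally ordered abelian group $\Gamma$ (additive, arbitrary rank) and a surjective homomorphism $v:\mathbb{K}^{*}\to\Gamma$ satisfying $v(x+y)\geq\min\{v(x),v(y)\}$, extended by $v(0)=\infty$, such that $R=\{x\in\mathbb{K}: v(x)\geq0\}$. $I_{0}=\{x: v(x)>0\}$ is its maximal ideal. $R$ is 2-Henselian if $2\neq0$ in $R$ and for every monic $f\in R[x]$ of degree 2 and every $a\in R$ with $v(f(a))>0$ and $v(f'(a))=0$ there is a root $b\in R$ of $f$ with $b-a\in I_{0}$. An $R$-lattice is a free $R$-module $M$ of finite rank with a symmetric bilinear form $(\cdot,\cdot):M\times M\to R$ which is non-degenerate, i.e. the induced map $M\to \mathrm{Hom}_{R}(M,R)$ is injective; it is unimodular if this map is bijective. Isomorphisms of lattices are $R$-module isomorphisms preserving the bilinear forms. $L(a)$ denotes $L$ with the bilinear form multiplied by $0\neq a\in R$. The valuation of a lattice $M$ is $v(M)=\min\{v((x,y)): x,y\in M\}$. A lattice is uni-valued if it is $L(\sigma)$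 with $L$ unimodular and $0\neq\sigma\in R$ (then its valuation is $v(\sigma)$). A Jordan decomposition of $M$ is an orthogonal direct sum decomposition $M=\bigoplus_{k=1}^{t}M_{k}$ into (non-zero) uni-valued lattices with pairwise distinct valuations. *)

theory Defs
  imports
    "HOL-Library.Extended"
    "HOL-Library.FuncSet"
    "HOL-Computational_Algebra.Polynomial_Factorial"
begin

(* The ring R is a type of class idom and K is its fraction field 'a fract. The valuation
   v : K* -> Gamma is a function on all of K whose value at 0 is irrelevant; ext_val v is its
   extension by infinity at 0. The element Minf of the type 'g extended is never a value. *)

definition ext_val :: "('k::field \<Rightarrow> 'g) \<Rightarrow> 'k \<Rightarrow> 'g extended" where
  "ext_val v x = (if x = 0 then Pinf else Fin (v x))"

locale valuation_ring =
  fixes v :: "'a::idom fract \<Rightarrow> 'g::linordered_ab_group_add"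
  assumes v_mult: "x \<noteq> 0 \<Longrightarrow> y \<noteq> 0 \<Longrightarrow> v (x * y) = v x + v y"
    and v_surj: "v ` (UNIV - {0}) = UNIV"
    and v_add: "ext_val v (x + y) \<ge> min (ext_val v x) (ext_val v y)"
    and ring_eq: "range to_fract = {x. ext_val v x \<ge> 0}"

definition rval :: "('a::idom fract \<Rightarrow> 'g) \<Rightarrow> 'a \<Rightarrow> 'g extended" where
  "rval v a = ext_val v (to_fract a)"

definition maximal_ideal :: "('a::idom fract \<Rightarrow> 'g::linordered_ab_group_add) \<Rightarrow> 'a set" where
  "maximal_ideal v = {a. rval v a > 0}"

locale two_henselian = valuation_ring v
  for v :: "'a::idom fract \<Rightarrow> 'g::linordered_ab_group_add" +
  assumes two_nonzero: "(2::'a) \<noteq> 0"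
    and henselian: "\<And>(f::'a poly) a. lead_coeff f = 1 \<Longrightarrow> degree f = 2 \<Longrightarrow>
      rval v (poly f a) > 0 \<Longrightarrow> rval v (poly (pderiv f) a) = 0 \<Longrightarrow>
      \<exists>b. poly f b = 0 \<and> b - a \<in> maximal_ideal v"

(* Lattices are carried by submodules L of an ambient R-module with scalar multiplication
   scale, so that a lattice and the summands of its decompositions are treated alike. The
   form b is only relevant on L. *)

definition free_of_finite_rank ::
    "('a::comm_ring_1 \<Rightarrow> 'm::ab_group_add \<Rightarrow> 'm) \<Rightarrow> 'm set \<Rightarrow> bool" where
  "free_of_finite_rank scale L \<longleftrightarrow>
     (\<exists>B. finite B \<and> \<not> module.dependent scale B \<and> module.span scale B = L)"

definition dual_module ::
    "('a::comm_ring_1 \<Rightarrow> 'm::ab_group_add \<Rightarrow> 'm) \<Rightarrow> 'm set \<Rightarrow> ('m \<Rightarrow> 'a) set" where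
  "dual_module scale L = {f \<in> extensional L.
     (\<forall>x\<in>L. \<forall>y\<in>L. f (x + y) = f x + f y) \<and> (\<forall>c. \<forall>x\<in>L. f (scale c x) = c * f x)}"

definition induced_map :: "'m set \<Rightarrow> ('m \<Rightarrow> 'm \<Rightarrow> 'a) \<Rightarrow> 'm \<Rightarrow> 'm \<Rightarrow> 'a" where
  "induced_map L b x = restrict (b x) L"

locale bilinear_lattice = module scale
  for scale :: "'a::idom \<Rightarrow> 'm::ab_group_add \<Rightarrow> 'm" +
  fixes L :: "'m set" and b :: "'m \<Rightarrow> 'm \<Rightarrow> 'a"
  assumes free: "free_of_finite_rank scale L"
    and form_sym: "x \<in> L \<Longrightarrow> y \<in> L \<Longrightarrow> b x y = b y x"
    and form_add: "x \<in> L \<Longrightarrow> y \<in> L \<Longrightarrow> z \<in> L \<Longrightarrow> b (x + y) z = b x z + b y z"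
    and form_scale: "x \<in> L \<Longrightarrow> z \<in> L \<Longrightarrow> b (scale c x) z = c * b x z"
    and nondegenerate: "inj_on (induced_map L b) L"

locale unimodular_lattice = bilinear_lattice +
  assumes unimodular: "bij_betw (induced_map L b) L (dual_module scale L)"

definition uni_valued ::
    "('a::idom \<Rightarrow> 'm::ab_group_add \<Rightarrow> 'm) \<Rightarrow> 'm set \<Rightarrow> ('m \<Rightarrow> 'm \<Rightarrow> 'a) \<Rightarrow> bool" where
  "uni_valued scale L b \<longleftrightarrow>
     (\<exists>\<sigma> b'. \<sigma> \<noteq> 0 \<and> unimodular_lattice scale L b' \<and>
        (\<forall>x\<in>L. \<forall>y\<in>L. b x y = \<sigma> * b' x y))"

(* The minimum is attained for every lattice: it suffices to let x and y run through a basis. *)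
definition lattice_val ::
    "('a::idom fract \<Rightarrow> 'g::linordered_ab_group_add) \<Rightarrow> 'm set \<Rightarrow> ('m \<Rightarrow> 'm \<Rightarrow> 'a) \<Rightarrow> 'g extended" where
  "lattice_val v L b = (LEAST c. \<exists>x\<in>L. \<exists>y\<in>L. c = rval v (b x y))"

definition lattice_iso ::
    "('a::idom \<Rightarrow> 'm::ab_group_add \<Rightarrow> 'm) \<Rightarrow> 'm set \<Rightarrow> ('m \<Rightarrow> 'm \<Rightarrow> 'a) \<Rightarrow>
     ('a \<Rightarrow> 'n::ab_group_add \<Rightarrow> 'n) \<Rightarrow> 'n set \<Rightarrow> ('n \<Rightarrow> 'n \<Rightarrow> 'a) \<Rightarrow> bool" where
  "lattice_iso s1 L1 b1 s2 L2 b2 \<longleftrightarrow>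
     (\<exists>f. bij_betw f L1 L2 \<and>
        (\<forall>x\<in>L1. \<forall>y\<in>L1. f (x + y) = f x + f y) \<and>
        (\<forall>c. \<forall>x\<in>L1. f (s1 c x) = s2 c (f x)) \<and>
        (\<forall>x\<in>L1. \<forall>y\<in>L1. b2 (f x) (f y) = b1 x y))"

definition orthogonal_direct_sum ::
    "('a::idom \<Rightarrow> 'm::ab_group_add \<Rightarrow> 'm) \<Rightarrow> 'm set \<Rightarrow> ('m \<Rightarrow> 'm \<Rightarrow> 'a) \<Rightarrow>
     'i set \<Rightarrow> ('i \<Rightarrow> 'm set) \<Rightarrow> bool" where
  "orthogonal_direct_sum scale L b I P \<longleftrightarrow>
     (\<forall>i\<in>I. module.subspace scale (P i) \<and> P i \<subseteq> L) \<and>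
     (\<forall>x\<in>L. \<exists>!f. f \<in> Pi\<^sub>E I P \<and> x = (\<Sum>i\<in>I. f i)) \<and>
     (\<forall>i\<in>I. \<forall>j\<in>I. i \<noteq> j \<longrightarrow> (\<forall>x\<in>P i. \<forall>y\<in>P j. b x y = 0))"

definition jordan_decomposition ::
    "('a::idom fract \<Rightarrow> 'g::linordered_ab_group_add) \<Rightarrow> ('a \<Rightarrow> 'm::ab_group_add \<Rightarrow> 'm) \<Rightarrow>
     'm set \<Rightarrow> ('m \<Rightarrow> 'm \<Rightarrow> 'a) \<Rightarrow> nat \<Rightarrow> (nat \<Rightarrow> 'm set) \<Rightarrow> bool" where
  "jordan_decomposition v scale L b t P \<longleftrightarrow>
     orthogonal_direct_sum scale L b {1..t} P \<and>
     (\<forall>k\<in>{1..t}. P k \<noteq> {0} \<and> uni_valued scale (P k) b) \<and>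
     inj_on (\<lambda>k. lattice_val v (P k) b) {1..t}"

end

theory Submission
  imports Defs
begin

text \<open>An isometry \<open>\<phi>: M \<rightarrow> N\<close> need not map the Jordan component \<open>M\<^sub>k\<close> into a component of \<open>N\<close>, but
  up to smaller terms it does. Let \<open>M\<^sub>k\<close> be a unimodular lattice scaled by \<open>\<sigma>\<close>, and let \<open>\<tau>\<^sub>j\<close> be the
  corresponding scale of \<open>N\<^sub>j\<close>. For \<open>x\<close> in \<open>M\<^sub>k\<close> the products of \<open>\<phi> x\<close> with all of \<open>N\<close> are divisible
  by \<open>\<sigma>\<close>. Hence the component of \<open>\<phi> x\<close> in a summand \<open>N\<^sub>j\<close> with \<open>v(\<tau>\<^sub>j) < v(\<sigma>)\<close> is a multiple of
  \<open>\<sigma> / \<tau>\<^sub>j\<close>, and two such components have a product in \<open>\<sigma> (\<sigma> / \<tau>\<^sub>j) R\<close>; in a summand with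
  \<open>v(\<tau>\<^sub>j) > v(\<sigma>)\<close> all products lie in \<open>\<tau>\<^sub>j R\<close>. Both ideals are contained in \<open>\<sigma> I\<^sub>0\<close>. So modulo
  \<open>\<sigma> I\<^sub>0\<close> the form of \<open>M\<^sub>k\<close> is preserved by \<open>\<phi>\<close> followed by the projection to the one summand of \<open>N\<close>
  with the same valuation, which must exist because \<open>M\<^sub>k\<close> has a value that is not in \<open>\<sigma> I\<^sub>0\<close>
  (lemma \<open>isometry_near_isometry_of_component\<close>).

  After division by \<open>\<sigma>\<close> there remain two unimodular lattices and maps in both directions that
  preserve the forms modulo \<open>I\<^sub>0\<close>. Such lattices are isometric
  (lemma \<open>near_isometric_imp_isometric\<close>). Since \<open>2\<close> is a unit, an orthogonal system of vectors with
  unit norms that cannot be enlarged is a basis (lemma \<open>maximal_orthogonal_system_spans\<close>). The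
  image of such a system under a near isometry is orthogonal modulo \<open>I\<^sub>0\<close>; Gram-Schmidt makes it
  orthogonal, which changes the norms by factors in \<open>1 + I\<^sub>0\<close>. By the Henselian property these
  factors are squares, so the old norms can be restored (lemma \<open>approximate_gram_lift\<close>). Thus
  systems with the same norms exist in both lattices, a longest one in the first lattice yields a
  longest one in the second, and mapping one basis to the other is an isometry.

  The valuation enters only through divisibility: \<open>v(a) \<le> v(b)\<close> means that \<open>a\<close> divides \<open>b\<close>, and
  \<open>I\<^sub>0\<close> consists of the non-units.\<close>

section \<open>The valuation ring in terms of divisibility\<close>

context valuation_ring
begin

lemma val_one: "v 1 = 0"
proof -
  have "v (1 * 1) = v 1 + v 1" by (rule v_mult) auto
  then show ?thesis by simp
qed

lemma in_ring_iff: "x \<in> range to_fract \<longleftrightarrow> x = 0 \<or> 0 \<le> v x"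
  unfolding ring_eq by (auto simp: ext_val_def zero_extended_def)

lemma rval_one [simp]: "rval v 1 = 0"
  by (auto simp: rval_def ext_val_def val_one zero_extended_def)

text \<open>This equivalence translates all statements about valuations into divisibility: it says
  that the quotient \<open>b / a\<close> lies in the ring exactly if its valuation is non-negative.\<close>

lemma rval_le_iff_dvd: "rval v a \<le> rval v b \<longleftrightarrow> a dvd b"
proof (cases "a = 0 \<or> b = 0")
  case True
  then show ?thesis by (auto simp: rval_def ext_val_def)
next
  case False
  let ?q = "to_fract b / to_fract a"
  have q: "?q \<noteq> 0" "to_fract b = to_fract a * ?q"
    using False by auto
  have "v (to_fract b) = v (to_fract a) + v ?q"
    using q False by (metis v_mult to_fract_eq_0_iff)
  then have "rval v a \<le> rval v b \<longleftrightarrow> ?q \<in> range to_fract"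
    using q(1) False by (simp add: in_ring_iff rval_def ext_val_def)
  also have "\<dots> \<longleftrightarrow> a dvd b"
  proof
    assume "?q \<in> range to_fract"
    then obtain c where "?q = to_fract c" by blast
    then have "to_fract b = to_fract (a * c)" using q(2) by simp
    then show "a dvd b" by (metis to_fract_eq_iff dvd_triv_left)
  next
    assume "a dvd b"
    then obtain c where "b = a * c" by (auto elim: dvdE)
    then have "?q = to_fract c" using False by simp
    then show "?q \<in> range to_fract" by simp
  qed
  finally show ?thesis .
qed

lemma dvd_linear: "(a::'a) dvd b \<or> b dvd a"
  by (metis linear rval_le_iff_dvd)

lemma rval_eq_iff: "rval v a = rval v b \<longleftrightarrow> a dvd b \<and> b dvd a"
  by (metis order.eq_iff rval_le_iff_dvd)

lemma maximal_ideal_iff: "a \<in> maximal_ideal v \<longleftrightarrow> \<not> a dvd 1"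
proof -
  have "a \<in> maximal_ideal v \<longleftrightarrow> \<not> rval v a \<le> rval v 1"
    by (simp add: maximal_ideal_def not_le)
  then show ?thesis by (simp only: rval_le_iff_dvd)
qed

lemma maximal_ideal_zero [simp]: "0 \<in> maximal_ideal v"
  by (simp add: maximal_ideal_iff)

lemma maximal_ideal_mult: "a \<in> maximal_ideal v \<Longrightarrow> c * a \<in> maximal_ideal v"
  unfolding maximal_ideal_iff by (metis dvd_mult_right)

lemma maximal_ideal_add:
  assumes "a \<in> maximal_ideal v" "c \<in> maximal_ideal v"
  shows "a + c \<in> maximal_ideal v"
proof -
  consider "a dvd a + c" | "c dvd a + c"
    using dvd_linear[of a c] by auto
  then show ?thesis
    using assms unfolding maximal_ideal_iff by cases (metis dvd_trans)+
qed

lemma maximal_ideal_uminus: "a \<in> maximal_ideal v \<Longrightarrow> - a \<in> maximal_ideal v"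
  by (simp add: maximal_ideal_iff)

lemma maximal_ideal_diff:
  "a \<in> maximal_ideal v \<Longrightarrow> c \<in> maximal_ideal v \<Longrightarrow> a - c \<in> maximal_ideal v"
  using maximal_ideal_add[of a "- c"] maximal_ideal_uminus[of c] by simp

lemma maximal_ideal_sum:
  "(\<And>i. i \<in> I \<Longrightarrow> f i \<in> maximal_ideal v) \<Longrightarrow> (\<Sum>i\<in>I. f i) \<in> maximal_ideal v"
  by (induction I rule: infinite_finite_induct) (auto intro: maximal_ideal_add)

lemma unit_near_unit:
  assumes "u dvd 1" "w - u \<in> maximal_ideal v"
  shows "w dvd 1"
  using assms maximal_ideal_diff[of w "w - u"] by (auto simp: maximal_ideal_iff)

text \<open>A finite set of ring elements generates a principal ideal: an element of least valuation
  divides all the others.\<close>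

lemma finite_set_dvd_least:
  assumes "finite S" "S \<noteq> {}"
  shows "\<exists>d\<in>S. \<forall>a\<in>S. (d::'a) dvd a"
  using assms
proof (induction S rule: finite_ne_induct)
  case (insert x S)
  then obtain d where d: "d \<in> S" "\<forall>a\<in>S. d dvd a" by blast
  then show ?case
    using dvd_linear[of d x] by (metis dvd_trans dvd_refl insert_iff)
qed auto

end

locale nondyadic_henselian = two_henselian v
  for v :: "'a::idom fract \<Rightarrow> 'g::linordered_ab_group_add" +
  assumes two_unit: "(2::'a) dvd 1"
begin

text \<open>The form in which the Henselian property enters the lifting of isometries: the polynomial
  \<open>X\<^sup>2 - (1 + m)\<close> has the approximate root \<open>1\<close>, where its derivative is the unit \<open>2\<close>.\<close>

lemma square_root_near_one:
  assumes m: "m \<in> maximal_ideal v"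
  shows "\<exists>r. r * r = 1 + m \<and> r - 1 \<in> maximal_ideal v"
proof -
  let ?f = "[:- (1 + m), 0, 1:]"
  have "rval v (2::'a) = rval v 1" using two_unit by (simp only: rval_eq_iff) simp
  then have "rval v (poly (pderiv ?f) 1) = 0"
    by (simp add: pderiv_pCons)
  moreover have "rval v (poly ?f 1) > 0"
    using maximal_ideal_uminus[OF m] by (simp add: maximal_ideal_def)
  ultimately obtain r where "poly ?f r = 0" "r - 1 \<in> maximal_ideal v"
    using henselian[of ?f 1] by auto
  then show ?thesis by (auto simp: algebra_simps intro!: exI[of _ r])
qed

end

section \<open>Linear dependence over a domain\<close>

text \<open>Fraction-free Gaussian elimination: one unknown is eliminated at the price of
  multiplying the remaining equations by a pivot.\<close>

lemma homogeneous_system_nontrivial_solution: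
  fixes a :: "'i \<Rightarrow> 'j \<Rightarrow> 'r::idom"
  assumes "finite J" "finite I" "card J < card I"
  shows "\<exists>c. (\<exists>i\<in>I. c i \<noteq> 0) \<and> (\<forall>j\<in>J. (\<Sum>i\<in>I. c i * a i j) = 0)"
  using assms
proof (induction J arbitrary: I a rule: finite_induct)
  case empty
  then have "I \<noteq> {}" by auto
  then show ?case by (auto intro!: exI[of _ "\<lambda>_. 1"])
next
  case (insert k J)
  show ?case
  proof (cases "\<forall>i\<in>I. a i k = 0")
    case True
    obtain c where "\<exists>i\<in>I. c i \<noteq> 0" "\<forall>j\<in>J. (\<Sum>i\<in>I. c i * a i j) = 0"
      using insert.IH[of I a] insert.prems insert.hyps by auto
    then show ?thesis using True by (intro exI[of _ c]) auto
  next
    case False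
    then obtain p where p: "p \<in> I" "a p k \<noteq> 0" by blast
    let ?I = "I - {p}"
    have "card J < card ?I" using insert.prems insert.hyps p by simp
    then obtain c where c: "\<exists>i\<in>?I. c i \<noteq> 0"
      "\<forall>j\<in>J. (\<Sum>i\<in>?I. c i * (a p k * a i j - a i k * a p j)) = 0"
      using insert.IH[of ?I "\<lambda>i j. a p k * a i j - a i k * a p j"] insert.prems by auto
    define c' where "c' i = (if i = p then - (\<Sum>i\<in>?I. c i * a i k) else a p k * c i)" for i
    have "(\<Sum>i\<in>I. c' i * a i j) = (\<Sum>i\<in>?I. c i * (a p k * a i j - a i k * a p j))" for j
    proof -
      have "(\<Sum>i\<in>I. c' i * a i j) = c' p * a p j + (\<Sum>i\<in>?I. c' i * a i j)"
        using insert.prems p by (simp add: sum.remove)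
      also have "(\<Sum>i\<in>?I. c' i * a i j) = (\<Sum>i\<in>?I. a p k * c i * a i j)"
        by (rule sum.cong) (auto simp: c'_def)
      also have "c' p * a p j = (\<Sum>i\<in>?I. - (c i * a i k * a p j))"
        by (simp add: c'_def sum_distrib_right sum_negf)
      finally show ?thesis
        by (simp add: sum.distrib[symmetric] algebra_simps)
    qed
    moreover have "(\<Sum>i\<in>?I. c i * (a p k * a i k - a i k * a p k)) = 0"
      by (simp add: mult.commute)
    ultimately have "\<forall>j\<in>insert k J. (\<Sum>i\<in>I. c' i * a i j) = 0"
      using c(2) by auto
    moreover have "\<exists>i\<in>I. c' i \<noteq> 0" using c(1) p by (auto simp: c'_def)
    ultimately show ?thesis by blast
  qed
qed

section \<open>Symmetric forms and modular lattices\<close>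

locale symmetric_form = module scale
  for scale :: "'a::idom \<Rightarrow> 'm::ab_group_add \<Rightarrow> 'm" +
  fixes L :: "'m set" and b :: "'m \<Rightarrow> 'm \<Rightarrow> 'a"
  assumes sub: "subspace L"
    and sym: "x \<in> L \<Longrightarrow> y \<in> L \<Longrightarrow> b x y = b y x"
    and add_left: "x \<in> L \<Longrightarrow> y \<in> L \<Longrightarrow> z \<in> L \<Longrightarrow> b (x + y) z = b x z + b y z"
    and scale_left: "x \<in> L \<Longrightarrow> z \<in> L \<Longrightarrow> b (scale c x) z = c * b x z"
begin

lemmas L_add [intro, simp] = subspace_add[OF sub]
  and L_diff [intro, simp] = subspace_diff[OF sub]
  and L_scale [intro, simp] = subspace_scale[OF sub]
  and L_zero [intro, simp] = subspace_0[OF sub]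
  and L_sum [intro] = subspace_sum[OF sub]

lemma zero_left [simp]: "z \<in> L \<Longrightarrow> b 0 z = 0"
  using scale_left[of 0 z 0] by simp

lemma zero_right [simp]: "z \<in> L \<Longrightarrow> b z 0 = 0"
  using sym[of z 0] by simp

lemma add_right: "x \<in> L \<Longrightarrow> y \<in> L \<Longrightarrow> z \<in> L \<Longrightarrow> b z (x + y) = b z x + b z y"
  by (metis add_left sym L_add)

lemma scale_right: "x \<in> L \<Longrightarrow> z \<in> L \<Longrightarrow> b z (scale c x) = c * b z x"
  by (metis scale_left sym L_scale)

lemma diff_left: "x \<in> L \<Longrightarrow> y \<in> L \<Longrightarrow> z \<in> L \<Longrightarrow> b (x - y) z = b x z - b y z"
  using add_left[of "x - y" y z] by (auto simp: algebra_simps)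

lemma diff_right: "x \<in> L \<Longrightarrow> y \<in> L \<Longrightarrow> z \<in> L \<Longrightarrow> b z (x - y) = b z x - b z y"
  by (metis diff_left sym L_diff)

lemma sum_left:
  "(\<And>i. i \<in> I \<Longrightarrow> f i \<in> L) \<Longrightarrow> z \<in> L \<Longrightarrow> b (\<Sum>i\<in>I. f i) z = (\<Sum>i\<in>I. b (f i) z)"
  by (induction I rule: infinite_finite_induct) (auto simp: add_left L_sum)

lemma sum_right:
  "(\<And>i. i \<in> I \<Longrightarrow> f i \<in> L) \<Longrightarrow> z \<in> L \<Longrightarrow> b z (\<Sum>i\<in>I. f i) = (\<Sum>i\<in>I. b z (f i))"
  by (induction I rule: infinite_finite_induct) (auto simp: add_right L_sum)

lemma combination_left:
  assumes "\<And>i. i \<in> I \<Longrightarrow> f i \<in> L" "z \<in> L"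
  shows "b (\<Sum>i\<in>I. scale (c i) (f i)) z = (\<Sum>i\<in>I. c i * b (f i) z)"
  using assms by (subst sum_left) (simp_all add: scale_left)

lemma combination_right:
  assumes "\<And>i. i \<in> I \<Longrightarrow> f i \<in> L" "z \<in> L"
  shows "b z (\<Sum>i\<in>I. scale (c i) (f i)) = (\<Sum>i\<in>I. c i * b z (f i))"
  using assms by (subst sum_right) (simp_all add: scale_right)

end

sublocale bilinear_lattice \<subseteq> symmetric_form scale L b
proof
  show "subspace L" using free unfolding free_of_finite_rank_def by auto
qed (auto simp: form_sym form_add form_scale)

text \<open>This is the notion of a lattice \<open>L(\<sigma>)\<close> with \<open>L\<close> unimodular, in a form that does not
  mention the unimodular form and so makes sense for \<open>\<sigma>\<close> up to units: \<open>\<sigma>\<close> divides all values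
  of the form, and a vector whose products with \<open>L\<close> are all divisible by \<open>\<sigma> d\<close> lies in \<open>d L\<close>.
  The case \<open>d = 0\<close> is non-degeneracy.\<close>

locale modular_lattice = nondyadic_henselian v + symmetric_form scale L b
  for v :: "'a::idom fract \<Rightarrow> 'g::linordered_ab_group_add"
    and scale :: "'a \<Rightarrow> 'm::ab_group_add \<Rightarrow> 'm" and L :: "'m set" and b +
  fixes \<sigma> :: 'a
  assumes finitely_generated: "\<exists>B. finite B \<and> span B = L"
    and nonzero: "\<sigma> \<noteq> 0"
    and value_dvd: "x \<in> L \<Longrightarrow> y \<in> L \<Longrightarrow> \<sigma> dvd b x y"
    and divisible: "c \<in> L \<Longrightarrow> (\<And>y. y \<in> L \<Longrightarrow> \<sigma> * d dvd b c y) \<Longrightarrow> \<exists>l\<in>L. c = scale d l"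

text \<open>If \<open>d \<noteq> 0\<close> divides all values of the linear form \<open>b' c\<close> of a unimodular \<open>b'\<close>, then the quotient is
  again a linear form, hence is represented by some \<open>l\<close>, and \<open>c = d l\<close> by non-degeneracy.\<close>

lemma uni_valued_imp_modular:
  assumes "nondyadic_henselian v" "uni_valued scale L b"
  shows "\<exists>\<sigma>. modular_lattice v scale L b \<sigma>"
proof -
  interpret nondyadic_henselian v by fact
  obtain \<sigma> b' where \<sigma>: "\<sigma> \<noteq> 0" and "unimodular_lattice scale L b'"
    and b: "\<And>x y. x \<in> L \<Longrightarrow> y \<in> L \<Longrightarrow> b x y = \<sigma> * b' x y"
    using assms(2) unfolding uni_valued_def by blast
  interpret U: unimodular_lattice scale L b' by fact
  show ?thesis
  proof (intro exI, unfold_locales)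
    show "\<exists>B. finite B \<and> U.span B = L"
      using U.free unfolding free_of_finite_rank_def by blast
  next
    fix c d assume c: "c \<in> L" and "\<And>y. y \<in> L \<Longrightarrow> \<sigma> * d dvd b c y"
    then have "\<forall>y\<in>L. \<exists>q. b' c y = d * q"
      using \<sigma> b[OF c] by (fastforce simp: dvd_def)
    then obtain q where q: "\<And>y. y \<in> L \<Longrightarrow> b' c y = d * q y" by metis
    show "\<exists>l\<in>L. c = scale d l"
    proof (cases "d = 0")
      case True
      have "induced_map L b' c = induced_map L b' 0"
        using q True by (auto simp: induced_map_def fun_eq_iff restrict_def)
      then have "c = 0" using U.nondegenerate c by (auto dest: inj_onD)
      then show ?thesis using True by auto
    next
      case False
      have "restrict q L \<in> dual_module scale L"
      proof -
        have "q (x + y) = q x + q y" if "x \<in> L" "y \<in> L" for x y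
          using q[of "x + y"] q[of x] q[of y] that False c U.add_right[of x y c]
          by (auto simp flip: distrib_left)
        moreover have "q (scale e x) = e * q x" if "x \<in> L" for x e
        proof -
          have "d * q (scale e x) = e * (d * q x)"
            using q[of "scale e x"] q[of x] that c U.scale_right[of x c e] by auto
          then show ?thesis using False by (simp add: mult.left_commute)
        qed
        ultimately show ?thesis by (auto simp: dual_module_def)
      qed
      then obtain l where l: "l \<in> L" "induced_map L b' l = restrict q L"
        using U.unimodular by (metis bij_betw_imp_surj_on imageE)
      then have "b' l y = q y" if "y \<in> L" for y
        using that by (metis induced_map_def restrict_apply')
      then have "induced_map L b' c = induced_map L b' (scale d l)"
        using q l(1) by (auto simp: induced_map_def fun_eq_iff restrict_def U.scale_left)
      then have "c = scale d l"
        using U.nondegenerate c l(1) by (auto dest: inj_onD)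
      then show ?thesis using l(1) by blast
    qed
  qed (use \<sigma> in \<open>auto simp: b U.add_left U.scale_left U.sub distrib_left intro: U.sym\<close>)
qed

lemma modular_lattice_associated:
  assumes "modular_lattice v scale L b \<sigma>" "\<sigma> dvd \<tau>" "\<tau> dvd \<sigma>"
  shows "modular_lattice v scale L b \<tau>"
proof -
  interpret modular_lattice v scale L b \<sigma> by fact
  show ?thesis
  proof
    show "\<exists>B. finite B \<and> span B = L" by (rule finitely_generated)
    show "\<tau> \<noteq> 0" using nonzero assms(3) by auto
    show "\<tau> dvd b x y" if "x \<in> L" "y \<in> L" for x y
      using that value_dvd assms(3) dvd_trans by blast
    show "\<exists>l\<in>L. c = scale d l" if "c \<in> L" "\<And>y. y \<in> L \<Longrightarrow> \<tau> * d dvd b c y" for c d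
      using that(1)
    proof (rule divisible)
      fix y assume "y \<in> L"
      then show "\<sigma> * d dvd b c y"
        using that(2) assms(2) by (meson dvd_trans mult_dvd_mono dvd_refl)
    qed
  qed
qed

lemma (in modular_lattice) normalized_form:
  "\<exists>b'. modular_lattice v scale L b' 1 \<and> (\<forall>x\<in>L. \<forall>y\<in>L. b x y = \<sigma> * b' x y)"
proof -
  have "\<forall>x y. \<exists>q. x \<in> L \<longrightarrow> y \<in> L \<longrightarrow> b x y = \<sigma> * q"
    using value_dvd by (meson dvdE)
  then obtain b' where b': "\<And>x y. x \<in> L \<Longrightarrow> y \<in> L \<Longrightarrow> b x y = \<sigma> * b' x y"
    by metis
  have "modular_lattice v scale L b' 1"
  proof
    show "subspace L" by (rule sub)
    show "\<exists>B. finite B \<and> span B = L" by (rule finitely_generated)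
    fix x y assume xy: "x \<in> L" "y \<in> L"
    show "b' x y = b' y x"
      using b'[of x y] b'[of y x] sym xy nonzero by auto
    show "b' (scale c x) y = c * b' x y" for c
      using b'[of x y] b'[of "scale c x" y] scale_left[of x y c] xy nonzero
      by (auto simp: mult.left_commute)
    show "b' (x + z) y = b' x y + b' z y" if "z \<in> L" for z
      using b'[of x y] b'[of z y] b'[of "x + z" y] add_left[of x z y] xy nonzero that
      by (auto simp flip: distrib_left)
  next
    fix c d assume c: "c \<in> L" "\<And>y. y \<in> L \<Longrightarrow> 1 * d dvd b' c y"
    show "\<exists>l\<in>L. c = scale d l"
      using c by (intro divisible) (auto simp: b')
  qed auto
  then show ?thesis using b' by blast
qed

section \<open>Orthogonal systems in unimodular lattices\<close>

locale unimodular_form = modular_lattice v scale L b 1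
  for v :: "'a::idom fract \<Rightarrow> 'g::linordered_ab_group_add"
    and scale :: "'a \<Rightarrow> 'm::ab_group_add \<Rightarrow> 'm" and L :: "'m set" and b
begin

definition orthogonal_system :: "nat \<Rightarrow> (nat \<Rightarrow> 'm) \<Rightarrow> bool" where
  "orthogonal_system n e \<longleftrightarrow>
     (\<forall>i<n. e i \<in> L \<and> b (e i) (e i) dvd 1) \<and> (\<forall>i<n. \<forall>j<n. i \<noteq> j \<longrightarrow> b (e i) (e j) = 0)"

lemma form_combination:
  assumes "orthogonal_system n e" "j < n"
  shows "b (\<Sum>i<n. scale (c i) (e i)) (e j) = c j * b (e j) (e j)"
proof -
  have "b (\<Sum>i<n. scale (c i) (e i)) (e j) = (\<Sum>i<n. c i * b (e i) (e j))"
    using assms by (intro combination_left) (auto simp: orthogonal_system_def)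
  also have "\<dots> = (\<Sum>i<n. if i = j then c j * b (e j) (e j) else 0)"
    using assms by (intro sum.cong) (auto simp: orthogonal_system_def)
  finally show ?thesis using assms by simp
qed

text \<open>Orthogonal vectors of non-zero norm are linearly independent, and more vectors than there
  are generators are linearly dependent.\<close>

lemma orthogonal_system_length_bounded:
  "\<exists>N. \<forall>n e. orthogonal_system n e \<longrightarrow> n \<le> N"
proof -
  obtain B where B: "finite B" "span B = L" using finitely_generated by blast
  have "n \<le> card B" if e: "orthogonal_system n e" for n e
  proof (rule ccontr)
    assume "\<not> n \<le> card B"
    then have n: "card B < card {..<n}" by simp
    have "\<forall>i. \<exists>a. i < n \<longrightarrow> e i = (\<Sum>\<beta>\<in>B. scale (a \<beta>) \<beta>)"
      using e B span_finite[OF B(1)] unfolding orthogonal_system_def by auto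
    then obtain a where a: "\<And>i. i < n \<Longrightarrow> e i = (\<Sum>\<beta>\<in>B. scale (a i \<beta>) \<beta>)"
      by metis
    obtain c j where c: "j < n" "c j \<noteq> 0" "\<And>\<beta>. \<beta> \<in> B \<Longrightarrow> (\<Sum>i<n. c i * a i \<beta>) = 0"
      using homogeneous_system_nontrivial_solution[OF B(1) _ n, of a] by auto
    have "(\<Sum>i<n. scale (c i) (e i)) = (\<Sum>i<n. \<Sum>\<beta>\<in>B. scale (c i * a i \<beta>) \<beta>)"
      by (intro sum.cong) (auto simp: a scale_sum_right)
    also have "\<dots> = (\<Sum>\<beta>\<in>B. scale (\<Sum>i<n. c i * a i \<beta>) \<beta>)"
      by (subst sum.swap) (simp add: scale_sum_left)
    also have "\<dots> = 0" using c(3) by simp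
    finally have "c j * b (e j) (e j) = 0"
      using form_combination[OF e c(1), of c] e c(1) by (simp add: orthogonal_system_def)
    then show False using c(1,2) e by (auto simp: orthogonal_system_def)
  qed
  then show ?thesis by blast
qed

text \<open>The orthogonal projection \<open>p\<close> along the system maps \<open>L\<close> onto the orthogonal complement \<open>C\<close>, so
  the claim is that \<open>C = 0\<close>. The values of the form on \<open>C\<close> generate an ideal \<open>d R\<close>, where \<open>d\<close> is
  itself a value. Unimodularity gives \<open>C = d C\<close>, so \<open>d\<close> is divisible by \<open>d\<^sup>2\<close> and is \<open>0\<close> or a unit.
  Maximality means that all norms on \<open>C\<close> are non-units; by polarization, which needs the unit
  \<open>2\<close>, all values on \<open>C\<close> are non-units. Hence \<open>d = 0\<close>.\<close>

lemma maximal_orthogonal_system_spans: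
  assumes e: "orthogonal_system n e"
    and maximal: "\<And>c. c \<in> L \<Longrightarrow> (\<And>i. i < n \<Longrightarrow> b c (e i) = 0) \<Longrightarrow> \<not> b c c dvd 1"
    and w: "\<And>i. i < n \<Longrightarrow> w i * b (e i) (e i) = 1"
    and x: "x \<in> L"
  shows "x = (\<Sum>i<n. scale (w i * b x (e i)) (e i))"
proof -
  define p where "p x = x - (\<Sum>i<n. scale (w i * b x (e i)) (e i))" for x
  have eL: "e i \<in> L" if "i < n" for i
    using e that by (auto simp: orthogonal_system_def)
  have pL: "p x \<in> L" if "x \<in> L" for x
    using that eL unfolding p_def by (intro L_diff L_sum) auto
  have p_orth: "b (p x) (e i) = 0" if "x \<in> L" "i < n" for x i
  proof -
    have "b (p x) (e i) = b x (e i) - w i * b x (e i) * b (e i) (e i)"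
      unfolding p_def using that eL form_combination[OF e that(2), of "\<lambda>i. w i * b x (e i)"]
      by (subst diff_left) auto
    also have "w i * b x (e i) * b (e i) (e i) = b x (e i) * (w i * b (e i) (e i))"
      by (simp add: mult_ac)
    finally show ?thesis using w[OF that(2)] by simp
  qed
  have p_add: "p (x + y) = p x + p y" if "x \<in> L" "y \<in> L" for x y
    unfolding p_def using that eL
    by (simp add: add_left distrib_left scale_left_distrib sum.distrib)
  have p_scale: "p (scale a x) = scale a (p x)" if "x \<in> L" for x a
    unfolding p_def using that eL
    by (simp add: scale_left scale_right_diff_distrib scale_sum_right mult_ac)
  have p_zero: "p 0 = 0"
    unfolding p_def using eL by simp
  have p_fix: "p c = c" if "c \<in> L" "\<And>i. i < n \<Longrightarrow> b c (e i) = 0" for c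
    using that by (simp add: p_def)
  have b_p: "b c x = b c (p x)" if "c \<in> L" "x \<in> L" "\<And>i. i < n \<Longrightarrow> b c (e i) = 0" for c x
  proof -
    have "b c (\<Sum>i<n. scale (w i * b x (e i)) (e i)) = 0"
      using that eL by (subst combination_right) auto
    moreover have "b c (p x) = b c x - b c (\<Sum>i<n. scale (w i * b x (e i)) (e i))"
      unfolding p_def using that eL by (intro diff_right L_sum) auto
    ultimately show ?thesis by simp
  qed
  obtain B where B: "finite B" "span B = L" using finitely_generated by blast
  then have BL: "B \<subseteq> L" using span_superset by blast
  show ?thesis
  proof (cases "B = {}")
    case True
    then have "x = 0" using B x by auto
    then show ?thesis using eL by simp
  next
    case False
    let ?S = "(\<lambda>(\<beta>, \<gamma>). b (p \<beta>) (p \<gamma>)) ` (B \<times> B)"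
    obtain d where d: "d \<in> ?S" "\<forall>a\<in>?S. d dvd a"
      using finite_set_dvd_least[of ?S] B(1) False by auto
    \<comment> \<open>A divisor of the values on the generators \<open>p \<beta>\<close> of \<open>C\<close> divides all values on \<open>C\<close>, by
      linearity in each argument.\<close>
    have "x \<in> L \<and> (\<forall>\<gamma>\<in>B. d dvd b (p x) (p \<gamma>))" if "x \<in> L" for x
      using that unfolding B(2)[symmetric]
    proof (induction rule: span_induct)
      case base
      show ?case unfolding B(2)
        using BL pL by (intro subspaceI) (auto simp: p_add p_scale add_left scale_left p_zero)
    qed (use d(2) BL B in auto)
    then have d1: "d dvd b (p x) (p \<gamma>)" if "x \<in> L" "\<gamma> \<in> B" for x \<gamma>
      using that by blast
    have "y \<in> L \<and> (\<forall>x\<in>L. d dvd b (p x) (p y))" if "y \<in> L" for y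
      using that unfolding B(2)[symmetric]
    proof (induction rule: span_induct)
      case base
      show ?case unfolding B(2)
        using pL by (intro subspaceI) (auto simp: p_add p_scale add_right scale_right p_zero)
    qed (use d1 BL B in auto)
    then have d2: "d dvd b (p x) (p y)" if "x \<in> L" "y \<in> L" for x y
      using that by blast
    \<comment> \<open>This is \<open>C = d C\<close>: a vector of \<open>C\<close> is \<open>d l\<close> with \<open>l\<close> in \<open>L\<close>, and applying \<open>p\<close> moves \<open>l\<close> to \<open>C\<close>.\<close>
    have pd: "\<exists>l\<in>L. p x = scale d (p l)" if "x \<in> L" for x
    proof -
      have "1 * d dvd b (p x) y" if "y \<in> L" for y
        using d2[OF \<open>x \<in> L\<close> that] b_p[OF pL[OF \<open>x \<in> L\<close>] that p_orth[OF \<open>x \<in> L\<close>]] by simp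
      then obtain l where l: "l \<in> L" "p x = scale d l"
        using divisible[OF pL[OF \<open>x \<in> L\<close>]] by blast
      have "p x = p (p x)"
        using p_fix[OF pL[OF \<open>x \<in> L\<close>] p_orth[OF \<open>x \<in> L\<close>]] by simp
      also have "\<dots> = scale d (p l)" using l p_scale by simp
      finally show ?thesis using l(1) by blast
    qed
    obtain \<beta> \<gamma> where \<beta>\<gamma>: "\<beta> \<in> L" "\<gamma> \<in> L" "d = b (p \<beta>) (p \<gamma>)"
      using d(1) BL by auto
    obtain l m where lm: "l \<in> L" "m \<in> L" "p \<beta> = scale d (p l)" "p \<gamma> = scale d (p m)"
      using pd \<beta>\<gamma> by metis
    have "b (p \<beta>) (p \<gamma>) = d * (d * b (p l) (p m))"
      unfolding lm(3,4) using lm(1,2) pL by (simp add: scale_left scale_right)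
    then have "d = d * (d * b (p l) (p m))"
      by (rule trans[OF \<beta>\<gamma>(3)])
    then have "d = 0 \<or> d dvd 1"
      by (metis dvd_triv_left mult.right_neutral mult_cancel_left)
    moreover have "\<not> d dvd 1"
    proof
      assume unit: "d dvd 1"
      let ?x = "p \<beta>" and ?y = "p \<gamma>"
      have norm: "b (p z) (p z) \<in> maximal_ideal v" if "z \<in> L" for z
        using maximal[OF pL[OF that] p_orth[OF that]] by (simp add: maximal_ideal_iff)
      have "2 * d = b (p (\<beta> + \<gamma>)) (p (\<beta> + \<gamma>)) - b ?x ?x - b ?y ?y"
        using \<beta>\<gamma> pL sym[of ?x ?y] by (simp add: p_add add_left add_right algebra_simps)
      also have "\<dots> \<in> maximal_ideal v"
        using \<beta>\<gamma> norm by (intro maximal_ideal_diff) auto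
      finally show False
        using two_unit unit mult_dvd_mono[of 2 1 d 1] by (simp add: maximal_ideal_iff)
    qed
    ultimately have "p x = 0" using pd[OF x] by auto
    then show ?thesis by (simp add: p_def)
  qed
qed

text \<open>Gram-Schmidt orthogonalization, one vector at a time. The coefficients subtracted from
  \<open>y n\<close> lie in \<open>I\<^sub>0\<close>, so the new vector \<open>g\<close> has norm \<open>u n\<close> up to a factor in \<open>1 + I\<^sub>0\<close>, whose square
  root \<open>r\<close> is near \<open>1\<close>; dividing \<open>g\<close> by \<open>r\<close> gives the exact norm. The last part of the conclusion,
  that \<open>f i\<close> and \<open>y i\<close> have the same products modulo \<open>I\<^sub>0\<close>, is what keeps the later coefficients
  in \<open>I\<^sub>0\<close> during the induction.\<close>

lemma approximate_gram_lift:
  assumes y: "\<And>i. i < n \<Longrightarrow> y i \<in> L"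
    and u: "\<And>i. i < n \<Longrightarrow> u i dvd 1"
    and norm: "\<And>i. i < n \<Longrightarrow> b (y i) (y i) - u i \<in> maximal_ideal v"
    and orth: "\<And>i j. i < n \<Longrightarrow> j < n \<Longrightarrow> i \<noteq> j \<Longrightarrow> b (y i) (y j) \<in> maximal_ideal v"
  shows "\<exists>f. orthogonal_system n f \<and> (\<forall>i<n. b (f i) (f i) = u i \<and>
    (\<forall>z\<in>L. b (f i) z - b (y i) z \<in> maximal_ideal v))"
  using assms
proof (induction n)
  case 0
  then show ?case by (auto simp: orthogonal_system_def)
next
  case (Suc n)
  then obtain f where f: "orthogonal_system n f" "\<And>i. i < n \<Longrightarrow> b (f i) (f i) = u i"
    "\<And>i z. i < n \<Longrightarrow> z \<in> L \<Longrightarrow> b (f i) z - b (y i) z \<in> maximal_ideal v"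
    by (auto simp: less_Suc_eq)
  have fL: "f i \<in> L" if "i < n" for i
    using f(1) that by (auto simp: orthogonal_system_def)
  have yn: "y n \<in> L" using Suc.prems by simp
  have "\<forall>i. \<exists>w. i < n \<longrightarrow> w * u i = 1"
    using Suc.prems(2) by (metis dvdE less_Suc_eq mult.commute)
  then obtain w where w: "\<And>i. i < n \<Longrightarrow> w i * u i = 1" by metis
  define c where "c i = w i * b (y n) (f i)" for i
  define g where "g = y n - (\<Sum>i<n. scale (c i) (f i))"
  have gL: "g \<in> L" unfolding g_def using fL yn by (intro L_diff L_sum) auto
  have g_orth: "b g (f j) = 0" if "j < n" for j
  proof -
    have "b g (f j) = b (y n) (f j) - c j * u j"
      unfolding g_def using fL yn that form_combination[OF f(1) that, of c] f(2)[OF that]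
      by (subst diff_left) auto
    also have "c j * u j = b (y n) (f j) * (w j * u j)"
      by (simp add: c_def mult_ac)
    finally show ?thesis using w[OF that] by simp
  qed
  have g_orth': "b (f j) g = 0" if "j < n" for j
    using g_orth[OF that] sym[OF gL fL[OF that]] by simp
  have c: "c i \<in> maximal_ideal v" if "i < n" for i
  proof -
    have "b (f i) (y n) - b (y i) (y n) \<in> maximal_ideal v" using f(3) that yn by simp
    moreover have "b (y i) (y n) \<in> maximal_ideal v" using Suc.prems(4) that by simp
    ultimately have "b (f i) (y n) \<in> maximal_ideal v"
      using maximal_ideal_add[of "b (f i) (y n) - b (y i) (y n)" "b (y i) (y n)"] by simp
    then show ?thesis
      unfolding c_def using sym fL that yn by (metis maximal_ideal_mult)
  qed
  have g_near: "b g z - b (y n) z \<in> maximal_ideal v" if "z \<in> L" for z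
  proof -
    have "b (\<Sum>i<n. scale (c i) (f i)) z = (\<Sum>i<n. c i * b (f i) z)"
      using that fL by (intro combination_left) auto
    moreover have "b g z = b (y n) z - b (\<Sum>i<n. scale (c i) (f i)) z"
      unfolding g_def using that fL yn by (intro diff_left L_sum) auto
    ultimately have "b g z - b (y n) z = - (\<Sum>i<n. b (f i) z * c i)"
      by (simp add: mult.commute)
    also have "\<dots> \<in> maximal_ideal v"
      using c by (intro maximal_ideal_uminus maximal_ideal_sum maximal_ideal_mult) auto
    finally show ?thesis .
  qed
  obtain w' where w': "w' * u n = 1"
    using Suc.prems(2)[of n] by (metis dvdE lessI mult.commute)
  have "b g g - u n = (b g g - b (y n) g) + (b g (y n) - b (y n) (y n)) + (b (y n) (y n) - u n)"
    using sym[OF gL yn] by simp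
  also have "\<dots> \<in> maximal_ideal v"
    using g_near gL yn Suc.prems(3) by (intro maximal_ideal_add) auto
  finally have "w' * (b g g - u n) \<in> maximal_ideal v" by (rule maximal_ideal_mult)
  then obtain r where r: "r * r = 1 + w' * (b g g - u n)" "r - 1 \<in> maximal_ideal v"
    using square_root_near_one by blast
  then have "r dvd 1" using unit_near_unit[of 1 r] by simp
  then obtain s where s: "s * r = 1" by (metis dvdE mult.commute)
  have "s - 1 = - (s * (r - 1))" using s by (simp add: algebra_simps)
  then have s1: "s - 1 \<in> maximal_ideal v"
    using r(2) by (metis maximal_ideal_mult maximal_ideal_uminus)
  have "u n * (r * r) = b g g + (w' * u n) * (b g g - u n) - (b g g - u n)"
    unfolding r(1) using w' by (simp add: algebra_simps)
  then have bgg: "b g g = u n * (r * r)" using w' by simp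
  define f' where "f' = f(n := scale s g)"
  have norm': "b (f' n) (f' n) = u n"
  proof -
    have "b (f' n) (f' n) = u n * (s * r) * (s * r)"
      using gL by (simp add: f'_def scale_left scale_right bgg mult_ac)
    then show ?thesis using s by simp
  qed
  have "b (f' n) z - b (y n) z \<in> maximal_ideal v" if "z \<in> L" for z
  proof -
    have "b (f' n) z - b (y n) z = b g z * (s - 1) + (b g z - b (y n) z)"
      using that gL by (simp add: f'_def scale_left algebra_simps)
    also have "\<dots> \<in> maximal_ideal v"
      using s1 g_near that by (intro maximal_ideal_add maximal_ideal_mult)
    finally show ?thesis .
  qed
  moreover have "orthogonal_system (Suc n) f'"
    using f(1) norm' gL g_orth g_orth' fL Suc.prems(2)
    by (auto simp: orthogonal_system_def f'_def less_Suc_eq scale_left scale_right)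
  moreover have "b (f' i) (f' i) = u i" if "i < n" for i
    using that f(2) by (simp add: f'_def)
  moreover have "b (f' i) z - b (y i) z \<in> maximal_ideal v" if "i < n" "z \<in> L" for i z
    using that f(3) by (simp add: f'_def)
  ultimately show ?case
    using norm' by (intro exI[of _ f']) (auto simp: less_Suc_eq)
qed

end

text \<open>Maps of sets suffice, because an orthogonal system is transferred by lifting the images of
  its finitely many vectors.\<close>

definition near_isometry ::
    "'a set \<Rightarrow> 'm set \<Rightarrow> ('m \<Rightarrow> 'm \<Rightarrow> 'a) \<Rightarrow> 'n set \<Rightarrow> ('n \<Rightarrow> 'n \<Rightarrow> 'a::idom) \<Rightarrow> bool" where
  "near_isometry I L b L' b' \<longleftrightarrow>
     (\<exists>g. g ` L \<subseteq> L' \<and> (\<forall>x\<in>L. \<forall>y\<in>L. b' (g x) (g y) - b x y \<in> I))"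

lemma near_isometry_transfers_orthogonal_system:
  assumes "unimodular_form v scale L b" "unimodular_form v scale' L' b'"
    and "near_isometry (maximal_ideal v) L b L' b'"
    and "unimodular_form.orthogonal_system L b n e"
  shows "\<exists>f. unimodular_form.orthogonal_system L' b' n f \<and> (\<forall>i<n. b' (f i) (f i) = b (e i) (e i))"
proof -
  interpret S: unimodular_form v scale L b by fact
  interpret T: unimodular_form v scale' L' b' by fact
  obtain g where g: "g ` L \<subseteq> L'" "\<And>x y. x \<in> L \<Longrightarrow> y \<in> L \<Longrightarrow> b' (g x) (g y) - b x y \<in> maximal_ideal v"
    using assms(3) unfolding near_isometry_def by blast
  have e: "\<And>i. i < n \<Longrightarrow> e i \<in> L" "\<And>i. i < n \<Longrightarrow> b (e i) (e i) dvd 1"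
    "\<And>i j. i < n \<Longrightarrow> j < n \<Longrightarrow> i \<noteq> j \<Longrightarrow> b (e i) (e j) = 0"
    using assms(4) by (auto simp: S.orthogonal_system_def)
  have "b' (g (e i)) (g (e j)) \<in> maximal_ideal v" if "i < n" "j < n" "i \<noteq> j" for i j
    using g(2)[of "e i" "e j"] e that by simp
  then have "\<exists>f. T.orthogonal_system n f \<and> (\<forall>i<n. b' (f i) (f i) = b (e i) (e i) \<and>
      (\<forall>z\<in>L'. b' (f i) z - b' (g (e i)) z \<in> maximal_ideal v))"
    using e g by (intro T.approximate_gram_lift) auto
  then show ?thesis by blast
qed

text \<open>A longest orthogonal system of \<open>L\<close> is transferred to \<open>L'\<close> with its norms. The result is again
  longest, since a longer system of \<open>L'\<close> could be transferred back. Both are therefore bases.\<close>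

lemma near_isometric_imp_isometric:
  assumes "unimodular_form v scale L b" "unimodular_form v scale' L' b'"
    and near: "near_isometry (maximal_ideal v) L b L' b'"
    and near': "near_isometry (maximal_ideal v) L' b' L b"
  shows "lattice_iso scale L b scale' L' b'"
proof -
  interpret S: unimodular_form v scale L b by fact
  interpret T: unimodular_form v scale' L' b' by fact
  note transfer = near_isometry_transfers_orthogonal_system[OF assms(1,2) near]
  note transfer' = near_isometry_transfers_orthogonal_system[OF assms(2,1) near']
  obtain N where N: "\<And>n e. S.orthogonal_system n e \<Longrightarrow> n \<le> N"
    using S.orthogonal_system_length_bounded by blast
  have "S.orthogonal_system 0 (\<lambda>_. 0)" by (simp add: S.orthogonal_system_def)
  then have "\<exists>n. (\<exists>e. S.orthogonal_system n e) \<and> (\<forall>m. (\<exists>e. S.orthogonal_system m e) \<longrightarrow> m \<le> n)"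
    using N by (intro Nat.ex_has_greatest_nat[of _ 0 N, simplified]) auto
  then obtain n e where e: "S.orthogonal_system n e"
    and max: "\<And>m e. S.orthogonal_system m e \<Longrightarrow> m \<le> n"
    by blast
  obtain f where f: "T.orthogonal_system n f" and ff: "\<And>i. i < n \<Longrightarrow> b' (f i) (f i) = b (e i) (e i)"
    using transfer[OF e] by blast
  have eL: "e i \<in> L" and fL: "f i \<in> L'" if "i < n" for i
    using e f that by (auto simp: S.orthogonal_system_def T.orthogonal_system_def)
  have e_max: "\<not> b c c dvd 1" if c: "c \<in> L" "\<And>i. i < n \<Longrightarrow> b c (e i) = 0" for c
  proof
    assume unit: "b c c dvd 1"
    have "b (e i) c = 0" if "i < n" for i
      using c(2)[OF that] S.sym[OF c(1) eL[OF that]] by simp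
    then have "S.orthogonal_system (Suc n) (e(n := c))"
      using e c unit by (auto simp: S.orthogonal_system_def less_Suc_eq)
    then show False using max by fastforce
  qed
  have f_max: "\<not> b' c c dvd 1" if c: "c \<in> L'" "\<And>i. i < n \<Longrightarrow> b' c (f i) = 0" for c
  proof
    assume unit: "b' c c dvd 1"
    have "b' (f i) c = 0" if "i < n" for i
      using c(2)[OF that] T.sym[OF c(1) fL[OF that]] by simp
    then have "T.orthogonal_system (Suc n) (f(n := c))"
      using f c unit by (auto simp: T.orthogonal_system_def less_Suc_eq)
    then show False using max transfer' by fastforce
  qed
  have "\<forall>i. \<exists>w. i < n \<longrightarrow> w * b (e i) (e i) = 1"
    using e unfolding S.orthogonal_system_def by (metis dvdE mult.commute)
  then obtain w where w: "\<And>i. i < n \<Longrightarrow> w i * b (e i) (e i) = 1" by metis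
  have expand: "x = (\<Sum>i<n. scale (w i * b x (e i)) (e i))" if "x \<in> L" for x
    using S.maximal_orthogonal_system_spans[OF e e_max w that] .
  have expand': "x = (\<Sum>i<n. scale' (w i * b' x (f i)) (f i))" if "x \<in> L'" for x
    using T.maximal_orthogonal_system_spans[OF f f_max _ that, of w] w ff by simp
  \<comment> \<open>The linear map taking \<open>e i\<close> to \<open>f i\<close>.\<close>
  define h where "h x = (\<Sum>i<n. scale' (w i * b x (e i)) (f i))" for x
  have hL: "h x \<in> L'" for x
    unfolding h_def using fL by auto
  have h_f: "b' (h x) (f i) = b x (e i)" if "x \<in> L" "i < n" for x i
  proof -
    have "b' (h x) (f i) = b x (e i) * (w i * b (e i) (e i))"
      unfolding h_def using T.form_combination[OF f that(2)] ff[OF that(2)] by (simp add: mult_ac)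
    then show ?thesis using w that by simp
  qed
  have h_add: "h (x + y) = h x + h y" if "x \<in> L" "y \<in> L" for x y
    unfolding h_def using that eL
    by (simp add: S.add_left distrib_left T.scale_left_distrib sum.distrib)
  have h_scale: "h (scale c x) = scale' c (h x)" if "x \<in> L" for x c
    unfolding h_def using that eL by (simp add: S.scale_left T.scale_sum_right mult_ac)
  have h_form: "b' (h x) (h y) = b x y" if "x \<in> L" "y \<in> L" for x y
  proof -
    have "b' (h x) (h y) = (\<Sum>i<n. w i * b y (e i) * b' (h x) (f i))"
      unfolding h_def[of y] using fL hL by (intro T.combination_right) auto
    also have "\<dots> = (\<Sum>i<n. w i * b y (e i) * b x (e i))"
      using that by (intro sum.cong) (auto simp: h_f)
    also have "\<dots> = b x (\<Sum>i<n. scale (w i * b y (e i)) (e i))"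
      using that eL by (subst S.combination_right) (auto simp: mult_ac)
    finally show ?thesis using expand[OF that(2)] by simp
  qed
  have "inj_on h L"
  proof (rule inj_onI)
    fix x y assume xy: "x \<in> L" "y \<in> L" "h x = h y"
    then have "b x (e i) = b y (e i)" if "i < n" for i
      using h_f that by metis
    then show "x = y" using expand[OF xy(1)] expand[OF xy(2)] by simp
  qed
  moreover have "h ` L = L'"
  proof
    show "L' \<subseteq> h ` L"
    proof
      fix z assume z: "z \<in> L'"
      let ?x = "\<Sum>i<n. scale (w i * b' z (f i)) (e i)"
      have xL: "?x \<in> L" using eL by auto
      have "b ?x (e i) = b' z (f i)" if "i < n" for i
      proof -
        have "b ?x (e i) = b' z (f i) * (w i * b (e i) (e i))"
          using S.form_combination[OF e that] by (simp add: mult_ac)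
        then show ?thesis using w that by simp
      qed
      then have "z = h ?x"
        unfolding h_def by (subst expand'[OF z]) (auto intro!: sum.cong)
      then show "z \<in> h ` L" using xL by (rule image_eqI)
    qed
  qed (use hL in auto)
  ultimately have "bij_betw h L L'" by (simp add: bij_betw_def)
  then show ?thesis
    unfolding lattice_iso_def using h_add h_scale h_form by blast
qed

section \<open>Comparing Jordan decompositions\<close>

context modular_lattice
begin

text \<open>Otherwise the empty orthogonal system would be maximal and span \<open>L\<close>.\<close>

lemma exists_norm_of_minimal_value:
  assumes "L \<noteq> {0}"
  shows "\<exists>x\<in>L. b x x dvd \<sigma>"
proof -
  obtain b' where "modular_lattice v scale L b' 1"
    and b': "\<And>x y. x \<in> L \<Longrightarrow> y \<in> L \<Longrightarrow> b x y = \<sigma> * b' x y"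
    using normalized_form by blast
  then interpret U: unimodular_form v scale L b' by (simp add: unimodular_form_def)
  have "\<exists>x\<in>L. b' x x dvd 1"
  proof (rule ccontr)
    assume none: "\<not> ?thesis"
    have "x = 0" if "x \<in> L" for x
      using U.maximal_orthogonal_system_spans[of 0 "\<lambda>_. 0" "\<lambda>_. 0" x] none that
      by (auto simp: U.orthogonal_system_def)
    then show False using assms L_zero by blast
  qed
  then show ?thesis
    using b' mult_dvd_mono[of \<sigma> \<sigma>] by fastforce
qed

lemma lattice_val_eq:
  assumes "L \<noteq> {0}"
  shows "lattice_val v L b = rval v \<sigma>"
proof -
  obtain x where x: "x \<in> L" "b x x dvd \<sigma>"
    using exists_norm_of_minimal_value[OF assms] by blast
  then have "rval v \<sigma> = rval v (b x x)"
    using value_dvd by (simp add: rval_eq_iff)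
  then have "\<exists>x\<in>L. \<exists>y\<in>L. rval v \<sigma> = rval v (b x y)" using x(1) by blast
  moreover have "rval v \<sigma> \<le> c" if "\<exists>x\<in>L. \<exists>y\<in>L. c = rval v (b x y)" for c
    using that value_dvd by (auto simp: rval_le_iff_dvd)
  ultimately show ?thesis
    unfolding lattice_val_def by (rule Least_equality)
qed

end

lemma near_isometry_cancel:
  fixes \<sigma> :: "'a::idom"
  assumes "near_isometry ((*) \<sigma> ` I) L b L' b'" "\<sigma> \<noteq> 0"
    and b: "\<And>x y. x \<in> L \<Longrightarrow> y \<in> L \<Longrightarrow> b x y = \<sigma> * c x y"
    and b': "\<And>x y. x \<in> L' \<Longrightarrow> y \<in> L' \<Longrightarrow> b' x y = \<sigma> * c' x y"
  shows "near_isometry I L c L' c'"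
proof -
  obtain g where "g ` L \<subseteq> L' \<and> (\<forall>x\<in>L. \<forall>y\<in>L. b' (g x) (g y) - b x y \<in> (*) \<sigma> ` I)"
    using assms(1) unfolding near_isometry_def by (rule exE)
  then have g: "g ` L \<subseteq> L'"
    "\<And>x y. x \<in> L \<Longrightarrow> y \<in> L \<Longrightarrow> b' (g x) (g y) - b x y \<in> (*) \<sigma> ` I"
    by auto
  have "c' (g x) (g y) - c x y \<in> I" if xy: "x \<in> L" "y \<in> L" for x y
  proof -
    have "g x \<in> L'" "g y \<in> L'" using g(1) xy by auto
    then have "\<sigma> * (c' (g x) (g y) - c x y) \<in> (*) \<sigma> ` I"
      using g(2)[OF xy] by (simp add: b b' xy right_diff_distrib)
    then show ?thesis using assms(2) by auto
  qed
  then show ?thesis unfolding near_isometry_def using g(1) by (intro exI[of _ g]) auto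
qed

lemma isometry_of_near_isometric_modular:
  assumes "modular_lattice v scale L b \<sigma>" "modular_lattice v scale' L' b' \<sigma>"
    and near: "near_isometry ((*) \<sigma> ` maximal_ideal v) L b L' b'"
    and near': "near_isometry ((*) \<sigma> ` maximal_ideal v) L' b' L b"
  shows "lattice_iso scale L b scale' L' b'"
proof -
  interpret S: modular_lattice v scale L b \<sigma> by fact
  interpret T: modular_lattice v scale' L' b' \<sigma> by fact
  obtain c where "modular_lattice v scale L c 1"
    and c: "\<And>x y. x \<in> L \<Longrightarrow> y \<in> L \<Longrightarrow> b x y = \<sigma> * c x y"
    using S.normalized_form by blast
  then have uc: "unimodular_form v scale L c" by (simp add: unimodular_form_def)
  obtain c' where "modular_lattice v scale' L' c' 1"
    and c': "\<And>x y. x \<in> L' \<Longrightarrow> y \<in> L' \<Longrightarrow> b' x y = \<sigma> * c' x y"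
    using T.normalized_form by blast
  then have uc': "unimodular_form v scale' L' c'" by (simp add: unimodular_form_def)
  have "near_isometry (maximal_ideal v) L c L' c'"
    using near S.nonzero c c' by (rule near_isometry_cancel)
  moreover have "near_isometry (maximal_ideal v) L' c' L c"
    using near' S.nonzero c' c by (rule near_isometry_cancel)
  ultimately have "lattice_iso scale L c scale' L' c'"
    using near_isometric_imp_isometric[OF uc uc'] by blast
  then obtain f where "bij_betw f L L'" "\<forall>x\<in>L. \<forall>y\<in>L. f (x + y) = f x + f y"
    "\<forall>a. \<forall>x\<in>L. f (scale a x) = scale' a (f x)" "\<forall>x\<in>L. \<forall>y\<in>L. c' (f x) (f y) = c x y"
    unfolding lattice_iso_def by blast
  then show ?thesis
    unfolding lattice_iso_def by (intro exI[of _ f]) (auto simp: c c' bij_betwE)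
qed

text \<open>The scales \<open>\<sigma> k\<close> of the components are determined up to units only, so having distinct
  valuations is expressed as not being associated.\<close>

locale jordan_lattice = nondyadic_henselian v + symmetric_form scale L b
  for v :: "'a::idom fract \<Rightarrow> 'g::linordered_ab_group_add"
    and scale :: "'a \<Rightarrow> 'm::ab_group_add \<Rightarrow> 'm" and L :: "'m set" and b +
  fixes t :: nat and P :: "nat \<Rightarrow> 'm set" and \<sigma> :: "nat \<Rightarrow> 'a"
  assumes decomposition: "orthogonal_direct_sum scale L b {1..t} P"
    and modular: "k \<in> {1..t} \<Longrightarrow> modular_lattice v scale (P k) b (\<sigma> k)"
    and component_nonzero: "k \<in> {1..t} \<Longrightarrow> P k \<noteq> {0}"
    and distinct_values: "i \<in> {1..t} \<Longrightarrow> j \<in> {1..t} \<Longrightarrow> i \<noteq> j \<Longrightarrow> \<not> (\<sigma> i dvd \<sigma> j \<and> \<sigma> j dvd \<sigma> i)"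
begin

definition component :: "nat \<Rightarrow> 'm \<Rightarrow> 'm" where
  "component k x = (THE f. f \<in> Pi\<^sub>E {1..t} P \<and> x = (\<Sum>i\<in>{1..t}. f i)) k"

lemma component_subset: "k \<in> {1..t} \<Longrightarrow> P k \<subseteq> L"
  using decomposition unfolding orthogonal_direct_sum_def by simp

lemma component_orthogonal:
  "i \<in> {1..t} \<Longrightarrow> j \<in> {1..t} \<Longrightarrow> i \<noteq> j \<Longrightarrow> x \<in> P i \<Longrightarrow> y \<in> P j \<Longrightarrow> b x y = 0"
  using decomposition unfolding orthogonal_direct_sum_def by simp

lemma
  assumes "x \<in> L"
  shows component_in: "k \<in> {1..t} \<Longrightarrow> component k x \<in> P k"
    and sum_components: "(\<Sum>k\<in>{1..t}. component k x) = x"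
proof -
  let ?f = "THE f. f \<in> Pi\<^sub>E {1..t} P \<and> x = (\<Sum>i\<in>{1..t}. f i)"
  have "\<exists>!f. f \<in> Pi\<^sub>E {1..t} P \<and> x = (\<Sum>i\<in>{1..t}. f i)"
    using decomposition assms unfolding orthogonal_direct_sum_def by simp
  then have f: "?f \<in> Pi\<^sub>E {1..t} P \<and> x = (\<Sum>i\<in>{1..t}. ?f i)" by (rule theI')
  then show "k \<in> {1..t} \<Longrightarrow> component k x \<in> P k"
    unfolding component_def by (rule PiE_mem[OF conjunct1])
  show "(\<Sum>k\<in>{1..t}. component k x) = x"
    unfolding component_def using f by simp
qed

lemma component_in_L: "x \<in> L \<Longrightarrow> k \<in> {1..t} \<Longrightarrow> component k x \<in> L"
  using component_in component_subset by blast

lemma form_component: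
  assumes x: "x \<in> L" and k: "k \<in> {1..t}" and z: "z \<in> P k"
  shows "b x z = b (component k x) z"
proof -
  have zL: "z \<in> L" using component_subset k z by blast
  have "b x z = b (\<Sum>i\<in>{1..t}. component i x) z" using sum_components[OF x] by simp
  also have "\<dots> = (\<Sum>i\<in>{1..t}. b (component i x) z)"
    using component_in_L[OF x] zL by (rule sum_left)
  also have "\<dots> = (\<Sum>i\<in>{1..t}. if i = k then b (component k x) z else 0)"
    using component_orthogonal component_in[OF x] k z by (intro sum.cong) auto
  finally show ?thesis using k by simp
qed

lemma form_components:
  assumes x: "x \<in> L" and y: "y \<in> L"
  shows "b x y = (\<Sum>k\<in>{1..t}. b (component k x) (component k y))"
proof -
  have "b x y = b x (\<Sum>k\<in>{1..t}. component k y)" using sum_components[OF y] by simp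
  also have "\<dots> = (\<Sum>k\<in>{1..t}. b x (component k y))"
    using component_in_L[OF y] x by (rule sum_right)
  also have "\<dots> = (\<Sum>k\<in>{1..t}. b (component k x) (component k y))"
    using form_component[OF x _ component_in[OF y]] by (intro sum.cong) auto
  finally show ?thesis .
qed

text \<open>If \<open>\<tau> = \<sigma>\<^sub>k d\<close>, both components are multiples of \<open>d\<close>, so their product is divisible by
  \<open>\<sigma>\<^sub>k d\<^sup>2 = \<tau> d\<close>; if \<open>\<sigma>\<^sub>k = \<tau> d\<close>, it is divisible by \<open>\<tau> d\<close> anyway. In both cases \<open>d\<close> is not a unit.\<close>

lemma component_of_other_value_negligible:
  assumes x: "x \<in> L" "\<And>z. z \<in> L \<Longrightarrow> \<tau> dvd b x z"
    and y: "y \<in> L" "\<And>z. z \<in> L \<Longrightarrow> \<tau> dvd b y z"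
    and k: "k \<in> {1..t}" and ne: "\<not> (\<sigma> k dvd \<tau> \<and> \<tau> dvd \<sigma> k)"
  shows "b (component k x) (component k y) \<in> (*) \<tau> ` maximal_ideal v"
proof -
  interpret K: modular_lattice v scale "P k" b "\<sigma> k" using modular[OF k] .
  note xk = component_in[OF x(1) k] and yk = component_in[OF y(1) k]
  consider d where "\<tau> = \<sigma> k * d" | d where "\<sigma> k = \<tau> * d"
    using dvd_linear[of "\<sigma> k" \<tau>] unfolding dvd_def by blast
  then show ?thesis
  proof cases
    case 1
    have "\<not> d dvd 1"
      using ne 1 mult_dvd_mono[of "\<sigma> k" "\<sigma> k" d 1] by auto
    then have d: "d \<in> maximal_ideal v" by (simp add: maximal_ideal_iff)
    have "\<exists>l\<in>P k. component k w = scale d l" if w: "w \<in> L" "\<And>z. z \<in> L \<Longrightarrow> \<tau> dvd b w z" for w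
      using component_in[OF w(1) k]
    proof (rule K.divisible)
      fix z assume "z \<in> P k"
      then show "\<sigma> k * d dvd b (component k w) z"
        using w(2)[of z] component_subset[OF k] form_component[OF w(1) k] 1 by auto
    qed
    then obtain l m where lm: "l \<in> P k" "component k x = scale d l"
      "m \<in> P k" "component k y = scale d m"
      using x y by metis
    obtain q where "b l m = \<sigma> k * q" using K.value_dvd[OF lm(1,3)] by (auto elim: dvdE)
    then have "b (component k x) (component k y) = \<tau> * (q * d)"
      using lm 1 by (simp add: K.scale_left K.scale_right mult_ac)
    then show ?thesis using maximal_ideal_mult[OF d] by blast
  next
    case 2
    have "\<not> d dvd 1"
      using ne 2 mult_dvd_mono[of \<tau> \<tau> d 1] by auto
    then have d: "d \<in> maximal_ideal v" by (simp add: maximal_ideal_iff)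
    obtain q where "b (component k x) (component k y) = \<sigma> k * q"
      using K.value_dvd[OF xk yk] by (auto elim: dvdE)
    then have "b (component k x) (component k y) = \<tau> * (q * d)"
      using 2 by (simp add: mult_ac)
    then show ?thesis using maximal_ideal_mult[OF d] by blast
  qed
qed

end

text \<open>The near isometry is the isometry \<open>f\<close> followed by the projection to \<open>Q j\<close>, where \<open>\<tau> j\<close> is
  associated to \<open>\<sigma> k\<close>. Such a \<open>j\<close> exists, for otherwise every summand of \<open>b' (f x) (f x)\<close> would be
  negligible and \<open>P k\<close> could not have a norm associated to \<open>\<sigma> k\<close>.\<close>

lemma isometry_near_isometry_of_component:
  assumes "jordan_lattice v scale L b t P \<sigma>" "jordan_lattice v scale' L' b' s Q \<tau>"
    and iso: "lattice_iso scale L b scale' L' b'" and k: "k \<in> {1..t}"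
  shows "\<exists>j\<in>{1..s}. \<sigma> k dvd \<tau> j \<and> \<tau> j dvd \<sigma> k \<and>
    near_isometry ((*) (\<sigma> k) ` maximal_ideal v) (P k) b (Q j) b'"
proof -
  interpret S: jordan_lattice v scale L b t P \<sigma> by fact
  interpret T: jordan_lattice v scale' L' b' s Q \<tau> by fact
  interpret K: modular_lattice v scale "P k" b "\<sigma> k" using S.modular[OF k] .
  let ?I = "(*) (\<sigma> k) ` maximal_ideal v"
  obtain f where f: "bij_betw f L L'" "\<And>x y. x \<in> L \<Longrightarrow> y \<in> L \<Longrightarrow> b' (f x) (f y) = b x y"
    using iso unfolding lattice_iso_def by blast
  have PL: "x \<in> L" if "x \<in> P k" for x using S.component_subset[OF k] that by blast
  have fL: "f x \<in> L'" if "x \<in> P k" for x using f(1) PL[OF that] by (rule bij_betwE[rule_format])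
  have dvd: "\<sigma> k dvd b' (f x) z" if x: "x \<in> P k" and z: "z \<in> L'" for x z
  proof -
    obtain z' where z': "z' \<in> L" "z = f z'"
      using f(1) z by (metis bij_betw_imp_surj_on imageE)
    have "b' (f x) z = b (S.component k z') x"
      using f(2)[OF PL[OF x] z'(1)] z' S.sym[OF PL[OF x] z'(1)] S.form_component[OF z'(1) k x] by simp
    then show ?thesis using K.value_dvd[OF S.component_in[OF z'(1) k] x] by simp
  qed
  have I_sum: "(\<Sum>j\<in>J. g j) \<in> ?I" if "\<And>j. j \<in> J \<Longrightarrow> g j \<in> ?I" for J and g :: "nat \<Rightarrow> _"
  proof -
    have "\<forall>j. \<exists>m. j \<in> J \<longrightarrow> m \<in> maximal_ideal v \<and> g j = \<sigma> k * m"
      using that by (auto simp: image_iff)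
    then obtain h where "\<And>j. j \<in> J \<Longrightarrow> h j \<in> maximal_ideal v \<and> g j = \<sigma> k * h j"
      by metis
    then have "(\<Sum>j\<in>J. g j) = \<sigma> k * (\<Sum>j\<in>J. h j)" "(\<Sum>j\<in>J. h j) \<in> maximal_ideal v"
      by (auto simp: sum_distrib_left intro: S.maximal_ideal_sum)
    then show ?thesis by blast
  qed
  have negligible: "b' (T.component j (f x)) (T.component j (f y)) \<in> ?I"
    if "x \<in> P k" "y \<in> P k" "j \<in> {1..s}" "\<not> (\<tau> j dvd \<sigma> k \<and> \<sigma> k dvd \<tau> j)" for x y j
    using that fL dvd by (intro T.component_of_other_value_negligible) auto
  have form: "b x y = (\<Sum>j\<in>{1..s}. b' (T.component j (f x)) (T.component j (f y)))"
    if "x \<in> P k" "y \<in> P k" for x y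
    using T.form_components[OF fL fL, OF that] f(2)[OF PL PL, OF that] by simp
  have "\<exists>j\<in>{1..s}. \<tau> j dvd \<sigma> k \<and> \<sigma> k dvd \<tau> j"
  proof (rule ccontr)
    assume none: "\<not> ?thesis"
    obtain x where x: "x \<in> P k" "b x x dvd \<sigma> k"
      using K.exists_norm_of_minimal_value S.component_nonzero[OF k] by blast
    have "b x x \<in> ?I"
      unfolding form[OF x(1) x(1)] using negligible x none by (intro I_sum) blast
    then obtain m where m: "m \<in> maximal_ideal v" "b x x = \<sigma> k * m" by blast
    then have "\<sigma> k * m dvd \<sigma> k * 1" using x by simp
    then have "m dvd 1" using K.nonzero by (simp only: dvd_mult_cancel_left) simp
    then show False using m(1) by (simp add: S.maximal_ideal_iff)
  qed
  then obtain j where j: "j \<in> {1..s}" "\<tau> j dvd \<sigma> k" "\<sigma> k dvd \<tau> j" by blast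
  have "b' (T.component j (f x)) (T.component j (f y)) - b x y \<in> ?I"
    if xy: "x \<in> P k" "y \<in> P k" for x y
  proof -
    let ?g = "\<lambda>i. b' (T.component i (f x)) (T.component i (f y))"
    have "(\<Sum>i\<in>{1..s} - {j}. ?g i) \<in> ?I"
    proof (rule I_sum)
      fix i assume "i \<in> {1..s} - {j}"
      then have i: "i \<in> {1..s}" "i \<noteq> j" by auto
      have "\<not> (\<tau> i dvd \<sigma> k \<and> \<sigma> k dvd \<tau> i)"
        using T.distinct_values[OF i(1) j(1) i(2)] j by (meson dvd_trans)
      then show "?g i \<in> ?I" using negligible xy i(1) by blast
    qed
    then obtain m where m: "m \<in> maximal_ideal v" "(\<Sum>i\<in>{1..s} - {j}. ?g i) = \<sigma> k * m" by blast
    have "b x y = ?g j + (\<Sum>i\<in>{1..s} - {j}. ?g i)"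
      unfolding form[OF xy] using j(1) by (intro sum.remove) auto
    then have "?g j - b x y = \<sigma> k * (- m)" using m by simp
    then show ?thesis using S.maximal_ideal_uminus[OF m(1)] by blast
  qed
  moreover have "(\<lambda>x. T.component j (f x)) ` P k \<subseteq> Q j"
    using T.component_in fL j(1) by blast
  ultimately have "near_isometry ?I (P k) b (Q j) b'"
    unfolding near_isometry_def by (intro exI[of _ "\<lambda>x. T.component j (f x)"]) auto
  then show ?thesis using j by blast
qed

lemma lattice_iso_sym:
  assumes "symmetric_form scale L b" and "lattice_iso scale L b scale' L' b'"
  shows "lattice_iso scale' L' b' scale L b"
proof -
  interpret symmetric_form scale L b by fact
  obtain f where f: "bij_betw f L L'" "\<And>x y. x \<in> L \<Longrightarrow> y \<in> L \<Longrightarrow> f (x + y) = f x + f y"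
    "\<And>c x. x \<in> L \<Longrightarrow> f (scale c x) = scale' c (f x)"
    "\<And>x y. x \<in> L \<Longrightarrow> y \<in> L \<Longrightarrow> b' (f x) (f y) = b x y"
    using assms(2) unfolding lattice_iso_def by blast
  define g where "g = inv_into L f"
  have g: "bij_betw g L' L" unfolding g_def using f(1) by (rule bij_betw_inv_into)
  have gL: "g x \<in> L" and fg: "f (g x) = x" if "x \<in> L'" for x
    using bij_betwE[OF g] bij_betw_inv_into_right[OF f(1)] that by (auto simp: g_def)
  have gf: "g (f x) = x" if "x \<in> L" for x
    using bij_betw_inv_into_left[OF f(1) that] by (simp add: g_def)
  have "g (x + y) = g x + g y" if "x \<in> L'" "y \<in> L'" for x y
    using gf[of "g x + g y"] f(2)[of "g x" "g y"] gL fg that by simp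
  moreover have "g (scale' c x) = scale c (g x)" if "x \<in> L'" for x c
    using gf[of "scale c (g x)"] f(3)[of "g x" c] gL fg that by simp
  moreover have "b (g x) (g y) = b' x y" if "x \<in> L'" "y \<in> L'" for x y
    using f(4)[of "g x" "g y"] gL fg that by simp
  ultimately show ?thesis
    unfolding lattice_iso_def using g by blast
qed

text \<open>The inverse isometry gives a near isometry from \<open>Q j\<close> back to a component whose scale is
  associated to \<open>\<sigma> k\<close>, and this can only be \<open>P k\<close>.\<close>

lemma jordan_component_isometric:
  assumes S: "jordan_lattice v scale L b t P \<sigma>" and T: "jordan_lattice v scale' L' b' s Q \<tau>"
    and iso: "lattice_iso scale L b scale' L' b'" and k: "k \<in> {1..t}"
  shows "\<exists>j\<in>{1..s}. \<sigma> k dvd \<tau> j \<and> \<tau> j dvd \<sigma> k \<and> lattice_iso scale (P k) b scale' (Q j) b'"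
proof -
  interpret S: jordan_lattice v scale L b t P \<sigma> by fact
  interpret T: jordan_lattice v scale' L' b' s Q \<tau> by fact
  let ?I = "\<lambda>c. (*) c ` maximal_ideal v"
  obtain j where j: "j \<in> {1..s}" "\<sigma> k dvd \<tau> j" "\<tau> j dvd \<sigma> k"
    and near: "near_isometry (?I (\<sigma> k)) (P k) b (Q j) b'"
    using isometry_near_isometry_of_component[OF S T iso k] by blast
  have "lattice_iso scale' L' b' scale L b"
    using S.symmetric_form_axioms iso by (rule lattice_iso_sym)
  then obtain i where i: "i \<in> {1..t}" "\<tau> j dvd \<sigma> i" "\<sigma> i dvd \<tau> j"
    and near': "near_isometry (?I (\<tau> j)) (Q j) b' (P i) b"
    using isometry_near_isometry_of_component[OF T S _ j(1)] by blast
  have "i = k" using S.distinct_values[OF i(1) k] i j by (meson dvd_trans)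
  have "?I (\<tau> j) \<subseteq> ?I (\<sigma> k)"
  proof -
    obtain d where "\<tau> j = \<sigma> k * d" using j(2) by (auto elim: dvdE)
    then show ?thesis by (auto simp: mult.assoc S.maximal_ideal_mult)
  qed
  then have "near_isometry (?I (\<sigma> k)) (Q j) b' (P k) b"
    using near' unfolding \<open>i = k\<close> near_isometry_def by (meson subsetD)
  moreover have "modular_lattice v scale' (Q j) b' (\<sigma> k)"
    using modular_lattice_associated[OF T.modular[OF j(1)] j(3,2)] .
  ultimately show ?thesis
    using isometry_of_near_isometric_modular[OF S.modular[OF k] _ near] j by blast
qed

lemma jordan_decomposition_imp_jordan_lattice:
  assumes "nondyadic_henselian v" "bilinear_lattice scale L b"
    and jd: "jordan_decomposition v scale L b t P"
  shows "\<exists>\<sigma>. jordan_lattice v scale L b t P \<sigma> \<and>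
    (\<forall>k\<in>{1..t}. lattice_val v (P k) b = rval v (\<sigma> k))"
proof -
  interpret nondyadic_henselian v by fact
  interpret bilinear_lattice scale L b by fact
  have "\<forall>k. \<exists>c. k \<in> {1..t} \<longrightarrow> modular_lattice v scale (P k) b c"
    using jd uni_valued_imp_modular[OF assms(1)] unfolding jordan_decomposition_def by blast
  then obtain \<sigma> where \<sigma>: "\<And>k. k \<in> {1..t} \<Longrightarrow> modular_lattice v scale (P k) b (\<sigma> k)"
    by metis
  have ne: "P k \<noteq> {0}" if "k \<in> {1..t}" for k
    using jd that unfolding jordan_decomposition_def by blast
  have val: "lattice_val v (P k) b = rval v (\<sigma> k)" if "k \<in> {1..t}" for k
    using modular_lattice.lattice_val_eq[OF \<sigma> ne, OF that that] .
  have "jordan_lattice v scale L b t P \<sigma>"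
  proof (intro jordan_lattice.intro jordan_lattice_axioms.intro)
    show "nondyadic_henselian v" "symmetric_form scale L b" by unfold_locales
    show "orthogonal_direct_sum scale L b {1..t} P"
      using jd unfolding jordan_decomposition_def by blast
    fix i j assume ij: "i \<in> {1..t}" "j \<in> {1..t}" "i \<noteq> j"
    have "lattice_val v (P i) b \<noteq> lattice_val v (P j) b"
      using jd ij unfolding jordan_decomposition_def by (auto dest: inj_onD)
    then show "\<not> (\<sigma> i dvd \<sigma> j \<and> \<sigma> j dvd \<sigma> i)"
      using val ij by (simp flip: rval_eq_iff)
  qed (use \<sigma> ne in auto)
  then show ?thesis using val by blast
qed

text \<open>The \<open>k\<close>-th value of a strictly increasing enumeration is the one with exactly \<open>k\<close> values of the
  range below or equal to it.\<close>

lemma strict_mono_enumeration_unique: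
  fixes f g :: "nat \<Rightarrow> 'c::linorder"
  assumes f: "strict_mono_on {1..t} f" and g: "strict_mono_on {1..s} g"
    and range: "f ` {1..t} = g ` {1..s}"
  shows "t = s \<and> (\<forall>k\<in>{1..t}. f k = g k)"
proof -
  have rank: "card {x \<in> h ` {1..n}. x \<le> h k} = k"
    if h: "strict_mono_on {1..n} h" and k: "k \<in> {1..n}" for h :: "nat \<Rightarrow> 'c" and n k
  proof -
    have "{x \<in> h ` {1..n}. x \<le> h k} = h ` {1..k}"
      using k by (auto simp: strict_mono_on_less_eq[OF h])
    moreover have "inj_on h {1..k}"
      using strict_mono_on_imp_inj_on[OF h] k by (auto intro: inj_on_subset)
    ultimately show ?thesis by (simp add: card_image)
  qed
  have ts: "t = s"
    using card_image[OF strict_mono_on_imp_inj_on[OF f]] card_image[OF strict_mono_on_imp_inj_on[OF g]]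
      range by simp
  moreover have "f k = g k" if k: "k \<in> {1..t}" for k
  proof -
    obtain j where j: "j \<in> {1..s}" "f k = g j" using range k by (metis imageE imageI)
    have "k = j" using rank[OF f k] rank[OF g j(1)] range j(2) by simp
    then show ?thesis using j by simp
  qed
  ultimately show ?thesis by blast
qed

theorem theorem2p4:
  fixes v :: "'a::idom fract \<Rightarrow> 'g::linordered_ab_group_add"
    and scaleM :: "'a \<Rightarrow> 'm::ab_group_add \<Rightarrow> 'm"
    and scaleN :: "'a \<Rightarrow> 'n::ab_group_add \<Rightarrow> 'n"
    and M :: "'m set" and bM :: "'m \<Rightarrow> 'm \<Rightarrow> 'a"
    and N :: "'n set" and bN :: "'n \<Rightarrow> 'n \<Rightarrow> 'a"
    and Mk :: "nat \<Rightarrow> 'm set" and Nk :: "nat \<Rightarrow> 'n set"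
    and t s :: nat
  assumes "two_henselian v"
    and "(2::'a) dvd 1"
    and "bilinear_lattice scaleM M bM"
    and "bilinear_lattice scaleN N bN"
    and "jordan_decomposition v scaleM M bM t Mk"
    and "jordan_decomposition v scaleN N bN s Nk"
    and "strict_mono_on {1..t} (\<lambda>k. lattice_val v (Mk k) bM)"
    and "strict_mono_on {1..s} (\<lambda>k. lattice_val v (Nk k) bN)"
    and "lattice_iso scaleM M bM scaleN N bN"
  shows "t = s \<and>
    (\<forall>k\<in>{1..t}. lattice_iso scaleM (Mk k) bM scaleN (Nk k) bN \<and>
       lattice_val v (Mk k) bM = lattice_val v (Nk k) bN)"
proof -
  interpret two_henselian v by fact
  have R: "nondyadic_henselian v" using assms(2) by unfold_locales
  interpret M: bilinear_lattice scaleM M bM by fact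
  obtain \<sigma> where S: "jordan_lattice v scaleM M bM t Mk \<sigma>"
    and valM: "\<And>k. k \<in> {1..t} \<Longrightarrow> lattice_val v (Mk k) bM = rval v (\<sigma> k)"
    using jordan_decomposition_imp_jordan_lattice[OF R assms(3,5)] by blast
  obtain \<tau> where T: "jordan_lattice v scaleN N bN s Nk \<tau>"
    and valN: "\<And>k. k \<in> {1..s} \<Longrightarrow> lattice_val v (Nk k) bN = rval v (\<tau> k)"
    using jordan_decomposition_imp_jordan_lattice[OF R assms(4,6)] by blast
  have iso': "lattice_iso scaleN N bN scaleM M bM"
    using M.symmetric_form_axioms assms(9) by (rule lattice_iso_sym)
  have partner: "\<exists>j\<in>{1..s}. lattice_val v (Mk k) bM = lattice_val v (Nk j) bN \<and>
      lattice_iso scaleM (Mk k) bM scaleN (Nk j) bN" if k: "k \<in> {1..t}" for k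
    using jordan_component_isometric[OF S T assms(9) k] valM[OF k] valN rval_eq_iff by metis
  have partner': "\<exists>k\<in>{1..t}. lattice_val v (Nk j) bN = lattice_val v (Mk k) bM"
    if j: "j \<in> {1..s}" for j
    using jordan_component_isometric[OF T S iso' j] valN[OF j] valM rval_eq_iff by metis
  have "(\<lambda>k. lattice_val v (Mk k) bM) ` {1..t} = (\<lambda>k. lattice_val v (Nk k) bN) ` {1..s}"
    using partner partner' by (fastforce simp: image_iff)
  then have eq: "t = s" "\<And>k. k \<in> {1..t} \<Longrightarrow> lattice_val v (Mk k) bM = lattice_val v (Nk k) bN"
    using strict_mono_enumeration_unique[OF assms(7,8)] by auto
  have "lattice_iso scaleM (Mk k) bM scaleN (Nk k) bN" if k: "k \<in> {1..t}" for k
  proof -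
    obtain j where j: "j \<in> {1..s}" "lattice_val v (Mk k) bM = lattice_val v (Nk j) bN"
      "lattice_iso scaleM (Mk k) bM scaleN (Nk j) bN"
      using partner[OF k] by blast
    have "lattice_val v (Nk k) bN = lattice_val v (Nk j) bN" using eq(2)[OF k] j(2) by simp
    then have "k = j"
      using strict_mono_on_imp_inj_on[OF assms(8)] k j(1) eq(1) by (auto dest: inj_onD)
    then show ?thesis using j(3) by simp
  qed
  then show ?thesis using eq by blast
qed

end
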